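(* Let $G=(V,E)$ be a co-chordal graph with at least one vertex and let $\mathcal{T}$ be a clique tree of its complement $G^c$. Then the output of $\mathrm{FindPartition}(\mathcal{T})$ (for any choices of edges made during the recursion) is a biclique partition of $G$ of size $\operatorname{mc}(G^c)-1$.
   Context: Graphs are finite and simple; $G$ is co-chordal if $G^c$ is chordal (no induced cycle of length $>3$). $\operatorname{mc}(H)$ is the number of maximal cliques of $H$. A clique tree of a chordal graph $H$ is a tree whose vertices are exactly the maximal cliques of $H$ and which satisfies the clique-intersection property: for any two maximal cliques $K_1,K_2$, every clique on the tree path between $K_1$ and $K_2$ contains $V(K_1)\cap V(K_2)$. For an edge $e=K'K''$ of a clique tree, its middle set is $\operatorname{mid}(e)=V(K')\cap V(K'')$. A biclique $\{L,R\}$ is the complete bipartite graph with disjoint vertex sets $L,R$ and edge set $\{uv:u\in L,v\in R\}$; a biclique partition of $G$ is a collection of biclique subgraphs of $G$ such that every edge of $G$ lies in exactly one of them. The recursive procedure $\mathrm{FindPartition}(\mathcal{T})$: if $\mathcal{T}$ has at most one vertex, return $\emptyset$; otherwise choose an arbitrary edge $e$ of $\mathcal{T}$, whose removal splits $\mathcal{T}$ into two subtrees $\mathcal{T}_1,\mathcal{T}_2$; set $L=\bigcup_{K\in V(\mathcal{T}_1)}V(K)\setminus\operatorname{mid}(e)$ and $R=\bigcup_{K\in V(\mathcal{T}_2)}V(K)\setminus\operatorname{mid}(e)$; return $\{\{L,R\}\}\cup\mathrm{FindPartition}(\mathcal{T}_1)\cup\mathrm{FindPartition}(\mathcal{T}_2)$.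 *)

theory Defs
  imports Main
begin

type_synonym 'a graph = "'a set \<times> 'a set set"

abbreviation verts :: "'a graph \<Rightarrow> 'a set" where "verts \<equiv> fst"
abbreviation edges :: "'a graph \<Rightarrow> 'a set set" where "edges \<equiv> snd"

definition all_pairs :: "'a set \<Rightarrow> 'a set set" where
  "all_pairs V = {{u, v} | u v. u \<in> V \<and> v \<in> V \<and> u \<noteq> v}"

definition simple_graph :: "'a graph \<Rightarrow> bool" where
  "simple_graph G \<longleftrightarrow> finite (verts G) \<and> edges G \<subseteq> all_pairs (verts G)"

definition complement :: "'a graph \<Rightarrow> 'a graph" where
  "complement G = (verts G, all_pairs (verts G) - edges G)"

definition subgraph :: "'a graph \<Rightarrow> 'a graph \<Rightarrow> bool" where
  "subgraph H G \<longleftrightarrow> verts H \<subseteq> verts G \<and> edges H \<subseteq> edges G"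

definition induced_subgraph :: "'a graph \<Rightarrow> 'a set \<Rightarrow> 'a graph" where
  "induced_subgraph G S = (S, {e \<in> edges G. e \<subseteq> S})"

definition delete_edge :: "'a graph \<Rightarrow> 'a set \<Rightarrow> 'a graph" where
  "delete_edge G e = (verts G, edges G - {e})"


definition path_between :: "'a graph \<Rightarrow> 'a \<Rightarrow> 'a list \<Rightarrow> 'a \<Rightarrow> bool" where
  "path_between G u xs v \<longleftrightarrow>
     xs \<noteq> [] \<and> hd xs = u \<and> last xs = v \<and> distinct xs \<and> set xs \<subseteq> verts G \<and>
     successively (\<lambda>x y. {x, y} \<in> edges G) xs"

definition connected_graph :: "'a graph \<Rightarrow> bool" where
  "connected_graph G \<longleftrightarrow> (\<forall>u\<in>verts G. \<forall>v\<in>verts G. \<exists>xs. path_between G u xs v)"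

definition component :: "'a graph \<Rightarrow> 'a \<Rightarrow> 'a graph" where
  "component G u = induced_subgraph G {v. \<exists>xs. path_between G u xs v}"

text \<open>A cycle is given by the list of its vertices in cyclic order.\<close>

definition cycle_edges :: "'a list \<Rightarrow> 'a set set" where
  "cycle_edges xs = {{xs ! i, xs ! (Suc i mod length xs)} | i. i < length xs}"

definition cycle_in :: "'a graph \<Rightarrow> 'a list \<Rightarrow> bool" where
  "cycle_in G xs \<longleftrightarrow>
     3 \<le> length xs \<and> distinct xs \<and> set xs \<subseteq> verts G \<and> cycle_edges xs \<subseteq> edges G"

definition induced_cycle_in :: "'a graph \<Rightarrow> 'a list \<Rightarrow> bool" where
  "induced_cycle_in G xs \<longleftrightarrow>
     cycle_in G xs \<and> edges (induced_subgraph G (set xs)) = cycle_edges xs"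

definition chordal :: "'a graph \<Rightarrow> bool" where
  "chordal G \<longleftrightarrow> \<not> (\<exists>xs. induced_cycle_in G xs \<and> 3 < length xs)"

definition co_chordal :: "'a graph \<Rightarrow> bool" where
  "co_chordal G \<longleftrightarrow> chordal (complement G)"

definition tree :: "'a graph \<Rightarrow> bool" where
  "tree T \<longleftrightarrow>
     simple_graph T \<and> verts T \<noteq> {} \<and> connected_graph T \<and> \<not> (\<exists>xs. cycle_in T xs)"


text \<open>A clique is identified with its vertex set.\<close>

definition clique :: "'a graph \<Rightarrow> 'a set \<Rightarrow> bool" where
  "clique H K \<longleftrightarrow> K \<subseteq> verts H \<and> (\<forall>u\<in>K. \<forall>v\<in>K. u \<noteq> v \<longrightarrow> {u, v} \<in> edges H)"

definition maximal_clique :: "'a graph \<Rightarrow> 'a set \<Rightarrow> bool" where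
  "maximal_clique H K \<longleftrightarrow> clique H K \<and> \<not> (\<exists>K'. clique H K' \<and> K \<subset> K')"

definition mc :: "'a graph \<Rightarrow> nat" where
  "mc H = card {K. maximal_clique H K}"

definition clique_tree :: "'a graph \<Rightarrow> 'a set graph \<Rightarrow> bool" where
  "clique_tree H T \<longleftrightarrow>
     tree T \<and> verts T = {K. maximal_clique H K} \<and>
     (\<forall>K\<^sub>1\<in>verts T. \<forall>K\<^sub>2\<in>verts T. \<forall>Ks. path_between T K\<^sub>1 Ks K\<^sub>2 \<longrightarrow>
        (\<forall>K\<in>set Ks. K\<^sub>1 \<inter> K\<^sub>2 \<subseteq> K))"


text \<open>A biclique is represented by the unordered pair of its two sides.\<close>

definition biclique :: "'a set set \<Rightarrow> bool" where
  "biclique B \<longleftrightarrow> (\<exists>L R. B = {L, R} \<and> L \<inter> R = {})"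

definition biclique_graph :: "'a set set \<Rightarrow> 'a graph" where
  "biclique_graph B = (\<Union> B, {{u, v} | u v. \<exists>L R. B = {L, R} \<and> u \<in> L \<and> v \<in> R})"

definition biclique_partition :: "'a graph \<Rightarrow> 'a set set set \<Rightarrow> bool" where
  "biclique_partition G P \<longleftrightarrow>
     (\<forall>B\<in>P. biclique B \<and> subgraph (biclique_graph B) G) \<and>
     (\<forall>e\<in>edges G. \<exists>!B. B \<in> P \<and> e \<in> edges (biclique_graph B))"


definition mid :: "'a set \<Rightarrow> 'a set \<Rightarrow> 'a set" where
  "mid K' K'' = K' \<inter> K''"

text \<open>
  The procedure is nondeterministic: \<open>find_partition T P\<close> says that \<open>P\<close> is the output on input
  \<open>T\<close> for some choice of edges in the recursion.
\<close>

inductive find_partition :: "'a set graph \<Rightarrow> 'a set set set \<Rightarrow> bool" where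
  stop: "find_partition T {}" if "finite (verts T)" "card (verts T) \<le> 1"
| split: "find_partition T ({{L, R}} \<union> P\<^sub>1 \<union> P\<^sub>2)"
    if "1 < card (verts T)"
      and "{K', K''} \<in> edges T"
      and "T\<^sub>1 = component (delete_edge T {K', K''}) K'"
      and "T\<^sub>2 = component (delete_edge T {K', K''}) K''"
      and "L = (\<Union>K\<in>verts T\<^sub>1. K) - mid K' K''"
      and "R = (\<Union>K\<in>verts T\<^sub>2. K) - mid K' K''"
      and "find_partition T\<^sub>1 P\<^sub>1"
      and "find_partition T\<^sub>2 P\<^sub>2"

end

theory Submission
  imports Defs
begin

text \<open>
  A graph is the union of its maximal cliques, so the edges of \<open>G\<close> are the pairs of vertices that
  no maximal clique of its complement contains. Removing an edge \<open>ab\<close> of the clique tree splits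
  the maximal cliques into two families whose unions \<open>U\<close> and \<open>W\<close> meet exactly in \<open>a \<inter> b\<close>, because
  every tree path from one family to the other passes through \<open>a\<close> and \<open>b\<close>. A pair of vertices that
  no clique contains therefore either lies within \<open>U\<close>, or within \<open>W\<close>, or joins \<open>U - W\<close> to \<open>W - U\<close>,
  and these cases exclude each other; induction over the recursion gives a biclique partition.
  As the maximal cliques form an antichain, each biclique has an edge. Hence no biclique is produced
  twice, and there is exactly one for each tree edge.
\<close>

section \<open>Reachability and components\<close>

definition adjacency :: "'a graph \<Rightarrow> 'a rel" where
  "adjacency G = {(u, v). {u, v} \<in> edges G}"

lemma rtrancl_adjacency_sym: "(u, v) \<in> (adjacency G)\<^sup>* \<Longrightarrow> (v, u) \<in> (adjacency G)\<^sup>*"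
  by (rule symD[OF sym_rtrancl]) (auto simp: adjacency_def insert_commute intro: symI)

lemma all_pairs_iff_card: "e \<in> all_pairs V \<longleftrightarrow> e \<subseteq> V \<and> card e = 2"
  by (auto simp: all_pairs_def card_2_iff)

lemma simple_graph_edgeD:
  assumes "simple_graph G" and "{u, v} \<in> edges G"
  shows "u \<in> verts G" and "v \<in> verts G" and "u \<noteq> v"
proof -
  have "{u, v} \<subseteq> verts G" and "card {u, v} = 2"
    using assms by (auto simp: simple_graph_def all_pairs_iff_card)
  then show "u \<in> verts G" and "v \<in> verts G" and "u \<noteq> v"
    by auto
qed

lemma path_between_prefix:
  assumes "path_between G u (xs @ w # ys) v"
  shows "path_between G u (xs @ [w]) w"
proof -
  have "successively (\<lambda>x y. {x, y} \<in> edges G) ((xs @ [w]) @ ys)"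
    using assms by (simp add: path_between_def)
  then have "successively (\<lambda>x y. {x, y} \<in> edges G) (xs @ [w])"
    unfolding successively_append_iff by (rule conjunct1)
  then show ?thesis
    using assms by (cases xs) (auto simp: path_between_def)
qed

lemma path_between_snoc:
  assumes "path_between G u xs v" and "{v, w} \<in> edges G" and "w \<in> verts G"
  obtains ys where "path_between G u ys w"
proof (cases "w \<in> set xs")
  case True
  then obtain as bs where "xs = as @ w # bs"
    by (meson split_list)
  then show thesis
    using assms(1) path_between_prefix that by metis
next
  case False
  then have "path_between G u (xs @ [w]) w"
    using assms by (auto simp: path_between_def successively_append_iff)
  then show thesis
    by (rule that)
qed

lemma path_between_imp_rtrancl:
  assumes "path_between G u xs v"
  shows "(u, v) \<in> (adjacency G)\<^sup>*"
proof -
  have "(hd xs, last xs) \<in> (adjacency G)\<^sup>*"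
    if "xs \<noteq> []" and "successively (\<lambda>x y. {x, y} \<in> edges G) xs" for xs
    using that
    by (induction xs rule: induct_list012)
      (auto simp: adjacency_def intro: converse_rtrancl_into_rtrancl)
  then show ?thesis
    using assms by (auto simp: path_between_def)
qed

lemma ex_path_between_iff_rtrancl:
  assumes "simple_graph G" and "u \<in> verts G"
  shows "(\<exists>xs. path_between G u xs v) \<longleftrightarrow> (u, v) \<in> (adjacency G)\<^sup>*"
proof
  assume "(u, v) \<in> (adjacency G)\<^sup>*"
  then show "\<exists>xs. path_between G u xs v"
  proof (induction rule: rtrancl_induct)
    case base
    have "path_between G u [u] u"
      using assms(2) by (simp add: path_between_def)
    then show ?case ..
  next
    case (step v w)
    then have "{v, w} \<in> edges G"
      by (simp add: adjacency_def)
    then show ?case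
      using step.IH path_between_snoc simple_graph_edgeD(2)[OF assms(1)] by metis
  qed
qed (auto intro: path_between_imp_rtrancl)

lemma connected_graph_iff_rtrancl:
  assumes "simple_graph G"
  shows "connected_graph G \<longleftrightarrow> verts G \<times> verts G \<subseteq> (adjacency G)\<^sup>*"
  using ex_path_between_iff_rtrancl[OF assms] by (auto simp: connected_graph_def)

lemma path_between_subgraph:
  assumes "path_between H u xs v" and "subgraph H G"
  shows "path_between G u xs v"
proof -
  have "successively (\<lambda>x y. {x, y} \<in> edges G) xs"
    by (rule successively_mono[where P = "\<lambda>x y. {x, y} \<in> edges H"])
      (use assms in \<open>auto simp: path_between_def subgraph_def\<close>)
  then show ?thesis
    using assms by (auto simp: path_between_def subgraph_def)
qed

lemma cycle_in_subgraph: "cycle_in H xs \<Longrightarrow> subgraph H G \<Longrightarrow> cycle_in G xs"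
  unfolding cycle_in_def subgraph_def by blast

lemma subgraph_trans: "subgraph F G \<Longrightarrow> subgraph G H \<Longrightarrow> subgraph F H"
  by (auto simp: subgraph_def)

lemma subgraph_delete_edge: "subgraph (delete_edge G e) G"
  by (auto simp: subgraph_def delete_edge_def)

lemma verts_component:
  assumes "simple_graph G" and "u \<in> verts G"
  shows "verts (component G u) = (adjacency G)\<^sup>* `` {u}"
  using ex_path_between_iff_rtrancl[OF assms]
  by (auto simp: component_def induced_subgraph_def)

lemma edges_component: "edges (component G u) = {e \<in> edges G. e \<subseteq> verts (component G u)}"
  by (simp add: component_def induced_subgraph_def)

lemma subgraph_component: "subgraph (component G u) G"
  by (auto simp: subgraph_def component_def induced_subgraph_def path_between_def)

lemma simple_graph_component:
  assumes "simple_graph G"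
  shows "simple_graph (component G u)"
proof -
  have "finite (verts (component G u))"
    using subgraph_component[of G u] assms
    by (auto simp: subgraph_def simple_graph_def intro: finite_subset)
  moreover have "edges (component G u) \<subseteq> all_pairs (verts (component G u))"
    using assms by (auto simp: edges_component simple_graph_def all_pairs_iff_card)
  ultimately show ?thesis
    by (simp add: simple_graph_def)
qed

lemma connected_component:
  assumes "simple_graph G" and "u \<in> verts G"
  shows "connected_graph (component G u)"
proof -
  let ?r = "adjacency (component G u)"
  have reach: "(u, v) \<in> ?r\<^sup>*" if "(u, v) \<in> (adjacency G)\<^sup>*" for v
    using that
  proof (induction rule: rtrancl_induct)
    case (step v w)
    have "{v, w} \<subseteq> verts (component G u)"
      using step.hyps by (auto simp: verts_component[OF assms])
    then have "(v, w) \<in> ?r"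
      using step.hyps by (simp add: adjacency_def edges_component)
    then show ?case
      using step.IH by simp
  qed simp
  have "(v, w) \<in> ?r\<^sup>*" if "v \<in> verts (component G u)" and "w \<in> verts (component G u)" for v w
  proof (rule rtrancl_trans)
    show "(v, u) \<in> ?r\<^sup>*"
      using that(1) by (simp add: verts_component[OF assms] reach rtrancl_adjacency_sym)
    show "(u, w) \<in> ?r\<^sup>*"
      using that(2) by (simp add: verts_component[OF assms] reach)
  qed
  then show ?thesis
    using connected_graph_iff_rtrancl[OF simple_graph_component[OF assms(1)]] by blast
qed

section \<open>Branches of a tree at an edge\<close>

definition forest :: "'a graph \<Rightarrow> bool" where
  "forest G \<longleftrightarrow> simple_graph G \<and> (\<nexists>xs. cycle_in G xs)"

lemma tree_iff_forest: "tree T \<longleftrightarrow> forest T \<and> verts T \<noteq> {} \<and> connected_graph T"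
  by (auto simp: tree_def forest_def)

lemma tree_imp_simple_graph: "tree T \<Longrightarrow> simple_graph T"
  by (simp add: tree_def)

lemma forest_delete_edge:
  assumes "forest G"
  shows "forest (delete_edge G e)"
proof -
  have "simple_graph (delete_edge G e)"
    using assms by (auto simp: forest_def simple_graph_def delete_edge_def)
  moreover have "\<not> cycle_in (delete_edge G e) xs" for xs
    using assms cycle_in_subgraph[OF _ subgraph_delete_edge[of G e]]
    unfolding forest_def by blast
  ultimately show ?thesis
    by (simp add: forest_def)
qed

lemma tree_component:
  assumes "forest G" and "u \<in> verts G"
  shows "tree (component G u)"
proof -
  have simple: "simple_graph G"
    using assms(1) by (simp add: forest_def)
  have "u \<in> verts (component G u)"
    by (simp add: verts_component[OF simple assms(2)])
  moreover have "\<not> cycle_in (component G u) xs" for xs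
    using assms(1) cycle_in_subgraph[OF _ subgraph_component[of G u]]
    unfolding forest_def by blast
  ultimately show ?thesis
    using simple_graph_component[OF simple] connected_component[OF simple assms(2)]
    by (auto simp: tree_def)
qed

lemma tree_ex_edge:
  assumes "tree T" and "1 < card (verts T)"
  obtains a b where "{a, b} \<in> edges T"
proof -
  obtain u v where uv: "u \<in> verts T" "v \<in> verts T" "u \<noteq> v"
    using assms(2) by (metis card_le_Suc0_iff_eq card.infinite One_nat_def not_le not_less0)
  then have "(u, v) \<in> (adjacency T)\<^sup>*"
    using assms(1) connected_graph_iff_rtrancl[of T] unfolding tree_def by blast
  then obtain w where "(u, w) \<in> adjacency T"
    using uv(3) by (cases rule: converse_rtranclE) simp_all
  then show thesis
    using that by (simp add: adjacency_def)
qed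

lemma nonadjacent_path_length_ge_3:
  assumes "path_between G u xs v" and "u \<noteq> v" and "{u, v} \<notin> edges G"
  shows "3 \<le> length xs"
proof (rule ccontr)
  assume "\<not> 3 \<le> length xs"
  then consider "length xs = 0" | "length xs = 1" | "length xs = 2"
    by linarith
  then show False
    using assms by cases (auto simp: path_between_def length_Suc_conv numeral_2_eq_2)
qed

lemma path_between_imp_cycle_in:
  assumes "path_between G a xs b" and "{a, b} \<in> edges G" and "3 \<le> length xs"
  shows "cycle_in G xs"
proof -
  have "{xs ! i, xs ! (Suc i mod length xs)} \<in> edges G" if i: "i < length xs" for i
  proof (cases "Suc i < length xs")
    case True
    then show ?thesis
      using assms(1) by (simp add: path_between_def successively_conv_nth)
  next
    case False
    then have "length xs = Suc i"
      using i by simp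
    then have "xs ! i = b" and "xs ! (Suc i mod length xs) = a"
      using assms(1) by (auto simp: path_between_def last_conv_nth hd_conv_nth)
    then show ?thesis
      using assms(2) by (simp add: insert_commute)
  qed
  then show ?thesis
    using assms by (auto simp: cycle_in_def path_between_def cycle_edges_def)
qed

definition branch :: "'a graph \<Rightarrow> 'a \<Rightarrow> 'a \<Rightarrow> 'a graph" where
  "branch T a b = component (delete_edge T {a, b}) a"

lemma subgraph_branch: "subgraph (branch T a b) T"
  unfolding branch_def by (rule subgraph_trans[OF subgraph_component subgraph_delete_edge])

lemma tree_branch: "forest T \<Longrightarrow> a \<in> verts T \<Longrightarrow> tree (branch T a b)"
  unfolding branch_def
  by (rule tree_component[OF forest_delete_edge]) (simp_all add: delete_edge_def)

lemma verts_branch: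
  assumes "simple_graph T" and "a \<in> verts T"
  shows "verts (branch T a b) = (adjacency (delete_edge T {a, b}))\<^sup>* `` {a}"
  unfolding branch_def
  by (rule verts_component) (use assms in \<open>auto simp: simple_graph_def delete_edge_def\<close>)

lemma ends_in_branches:
  assumes "simple_graph T" and "{a, b} \<in> edges T"
  shows "a \<in> verts (branch T a b)" and "b \<in> verts (branch T b a)"
  using simple_graph_edgeD[OF assms] by (simp_all add: verts_branch[OF assms(1)])

lemma branch_closed:
  assumes "simple_graph T" and "a \<in> verts T"
    and "x \<in> verts (branch T a b)" and "{x, y} \<in> edges T" and "{x, y} \<noteq> {a, b}"
  shows "y \<in> verts (branch T a b)"
proof -
  have "(x, y) \<in> adjacency (delete_edge T {a, b})"
    using assms(4,5) by (simp add: adjacency_def delete_edge_def)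
  then show ?thesis
    using assms(3) by (auto simp: verts_branch[OF assms(1,2)] intro: rtrancl_into_rtrancl)
qed

lemma branches_disjoint:
  assumes "forest T" and "{a, b} \<in> edges T"
  shows "verts (branch T a b) \<inter> verts (branch T b a) = {}"
proof (rule ccontr)
  let ?D = "delete_edge T {a, b}"
  have simple: "simple_graph T" "simple_graph ?D"
    using assms(1) forest_delete_edge[OF assms(1)] by (simp_all add: forest_def)
  note ends = simple_graph_edgeD[OF simple(1) assms(2)]
  assume "\<not> ?thesis"
  then obtain w where "(a, w) \<in> (adjacency ?D)\<^sup>*" "(b, w) \<in> (adjacency ?D)\<^sup>*"
    using verts_branch[OF simple(1)] ends by (auto simp: insert_commute)
  then have "(a, b) \<in> (adjacency ?D)\<^sup>*"
    using rtrancl_adjacency_sym rtrancl_trans by metis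
  then obtain xs where xs: "path_between ?D a xs b"
    using ex_path_between_iff_rtrancl[OF simple(2)] ends(1) by (auto simp: delete_edge_def)
  then have "3 \<le> length xs"
    using ends(3) by (rule nonadjacent_path_length_ge_3) (simp add: delete_edge_def)
  with path_between_subgraph[OF xs subgraph_delete_edge] have "cycle_in T xs"
    using assms(2) by (intro path_between_imp_cycle_in)
  then show False
    using assms(1) by (auto simp: forest_def)
qed

lemma branches_cover:
  assumes "tree T" and "{a, b} \<in> edges T"
  shows "verts (branch T a b) \<union> verts (branch T b a) = verts T"
    (is "?A \<union> ?B = _")
proof
  show "?A \<union> ?B \<subseteq> verts T"
    using subgraph_branch[of T] by (auto simp: subgraph_def)
  note simple = tree_imp_simple_graph[OF assms(1)]
  note ends = simple_graph_edgeD[OF simple assms(2)]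
    and roots = ends_in_branches[OF simple assms(2)]
  have "y \<in> ?A \<union> ?B" if "x \<in> ?A \<union> ?B" and "{x, y} \<in> edges T" for x y
  proof (cases "{x, y} = {a, b}")
    case True
    then show ?thesis
      using roots by (auto simp: doubleton_eq_iff)
  next
    case False
    then have "{x, y} \<noteq> {b, a}"
      by (simp add: insert_commute)
    then have "x \<in> ?B \<Longrightarrow> y \<in> ?B"
      using branch_closed[OF simple ends(2)] that(2) by simp
    moreover have "x \<in> ?A \<Longrightarrow> y \<in> ?A"
      using branch_closed[OF simple ends(1)] that(2) False by simp
    ultimately show ?thesis
      using that(1) by blast
  qed
  then have "adjacency T `` (?A \<union> ?B) \<subseteq> ?A \<union> ?B"
    by (auto simp: adjacency_def)
  then have "(adjacency T)\<^sup>* `` (?A \<union> ?B) = ?A \<union> ?B"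
    by (rule Image_closed_trancl)
  then show "verts T \<subseteq> ?A \<union> ?B"
    using assms(1) roots(1) ends(1) connected_graph_iff_rtrancl[OF simple]
    unfolding tree_def by blast
qed

lemma successively_ex_leaving_step:
  assumes "successively P xs" and "xs \<noteq> []" and "hd xs \<in> S" and "last xs \<notin> S"
  shows "\<exists>x\<in>set xs \<inter> S. \<exists>y\<in>set xs - S. P x y"
  using assms
proof (induction xs rule: induct_list012)
  case (3 x y zs)
  then show ?case
    by (cases "y \<in> S") auto
qed simp_all

lemma path_between_branches_crosses:
  assumes "forest T" and "{a, b} \<in> edges T" and "path_between T u xs v"
    and "u \<in> verts (branch T a b)" and "v \<in> verts (branch T b a)"
  shows "a \<in> set xs" and "b \<in> set xs"
proof -
  have simple: "simple_graph T"
    using assms(1) by (simp add: forest_def)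
  have "v \<notin> verts (branch T a b)"
    using branches_disjoint[OF assms(1,2)] assms(5) by blast
  then obtain x y where xy: "x \<in> set xs" "y \<in> set xs" "x \<in> verts (branch T a b)"
    "y \<notin> verts (branch T a b)" "{x, y} \<in> edges T"
    using successively_ex_leaving_step[of "\<lambda>x y. {x, y} \<in> edges T" xs "verts (branch T a b)"]
      assms(3,4)
    by (auto simp: path_between_def)
  then have "{x, y} = {a, b}"
    using branch_closed[OF simple] simple_graph_edgeD[OF simple assms(2)] by blast
  then show "a \<in> set xs" and "b \<in> set xs"
    using xy(1,2) by (auto simp: doubleton_eq_iff)
qed

section \<open>Biclique partitions\<close>

definition graph_union :: "'a graph \<Rightarrow> 'a graph \<Rightarrow> 'a graph" where
  "graph_union G H = (verts G \<union> verts H, edges G \<union> edges H)"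

lemma edges_biclique_graph:
  "edges (biclique_graph {L, R}) = {{u, v} | u v. u \<in> L \<and> v \<in> R}"
proof -
  have "edges (biclique_graph {L, R}) = {{u, v} | u v. u \<in> L \<and> v \<in> R \<or> v \<in> L \<and> u \<in> R}"
    unfolding biclique_graph_def snd_conv doubleton_eq_iff by blast
  also have "\<dots> = {{u, v} | u v. u \<in> L \<and> v \<in> R}"
    by (auto simp: doubleton_eq_iff)
  finally show ?thesis .
qed

lemma edges_biclique_graph_empty_iff: "edges (biclique_graph {L, R}) = {} \<longleftrightarrow> L = {} \<or> R = {}"
  unfolding edges_biclique_graph by blast

lemma biclique_partition_singleton:
  assumes "L \<inter> R = {}"
  shows "biclique_partition (biclique_graph {L, R}) {{L, R}}"
  using assms unfolding biclique_partition_def biclique_def subgraph_def by blast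

lemma biclique_partition_edges_subset:
  assumes "biclique_partition G P" and "B \<in> P"
  shows "edges (biclique_graph B) \<subseteq> edges G"
  using assms by (auto simp: biclique_partition_def subgraph_def)

lemma biclique_partition_graph_union:
  assumes P: "biclique_partition G P" and Q: "biclique_partition H Q"
    and disjoint: "edges G \<inter> edges H = {}"
  shows "biclique_partition (graph_union G H) (P \<union> Q)"
  unfolding biclique_partition_def
proof (intro conjI ballI)
  fix B assume "B \<in> P \<union> Q"
  then show "biclique B" and "subgraph (biclique_graph B) (graph_union G H)"
    using P Q by (auto simp: biclique_partition_def subgraph_def graph_union_def)
next
  fix e assume "e \<in> edges (graph_union G H)"
  then consider "e \<in> edges G" "e \<notin> edges H" | "e \<in> edges H" "e \<notin> edges G"
    using disjoint by (auto simp: graph_union_def)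
  then show "\<exists>!B. B \<in> P \<union> Q \<and> e \<in> edges (biclique_graph B)"
  proof cases
    case 1
    then have "\<exists>!B. B \<in> P \<and> e \<in> edges (biclique_graph B)"
      using P by (simp add: biclique_partition_def)
    then show ?thesis
      using biclique_partition_edges_subset[OF Q] 1(2) by blast
  next
    case 2
    then have "\<exists>!B. B \<in> Q \<and> e \<in> edges (biclique_graph B)"
      using Q by (simp add: biclique_partition_def)
    then show ?thesis
      using biclique_partition_edges_subset[OF P] 2(2) by blast
  qed
qed

lemma card_biclique_partition_graph_union:
  assumes "biclique_partition G P" and "biclique_partition H Q" and "edges G \<inter> edges H = {}"
    and "finite P" and "finite Q" and "\<And>B. B \<in> P \<Longrightarrow> edges (biclique_graph B) \<noteq> {}"
  shows "card (P \<union> Q) = card P + card Q"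
proof -
  have "P \<inter> Q = {}"
    using biclique_partition_edges_subset[OF assms(1)] biclique_partition_edges_subset[OF assms(2)]
      assms(3,6) by blast
  with assms(4,5) show ?thesis
    by (rule card_Un_disjoint)
qed

section \<open>Unions of cliques\<close>

definition clique_union :: "'a set set \<Rightarrow> 'a graph" where
  "clique_union F = (\<Union>F, \<Union>K\<in>F. all_pairs K)"

definition separation_graph :: "'a set set \<Rightarrow> 'a graph" where
  "separation_graph F = complement (clique_union F)"

lemma verts_separation_graph: "verts (separation_graph F) = \<Union>F"
  by (simp add: separation_graph_def complement_def clique_union_def)

lemma edges_separation_graph:
  "edges (separation_graph F) = {e. card e = 2 \<and> e \<subseteq> \<Union>F \<and> (\<forall>K\<in>F. \<not> e \<subseteq> K)}"
  by (simp add: separation_graph_def complement_def clique_union_def set_eq_iff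
      all_pairs_iff_card) blast

lemma edges_biclique_graph_Diff:
  "edges (biclique_graph {U - W, W - U}) =
     {e. card e = 2 \<and> e \<subseteq> U \<union> W \<and> \<not> e \<subseteq> U \<and> \<not> e \<subseteq> W}" (is "_ = ?E")
proof -
  have "e \<in> edges (biclique_graph {U - W, W - U})" if "e \<in> ?E" for e
  proof -
    have "card e = 2"
      using that by blast
    then obtain x y where "e = {x, y}"
      unfolding card_2_iff by blast
    then have "x \<in> U - W \<and> y \<in> W - U \<or> y \<in> U - W \<and> x \<in> W - U"
      using that by auto
    then show ?thesis
      unfolding edges_biclique_graph \<open>e = {x, y}\<close> by (auto simp: doubleton_eq_iff)
  qed
  moreover have "edges (biclique_graph {U - W, W - U}) \<subseteq> ?E"
    unfolding edges_biclique_graph by (auto simp: card_2_iff)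
  ultimately show ?thesis
    by blast
qed

lemma edges_separation_graph_disjoint:
  assumes "K \<in> F\<^sub>1" and "\<Union>F\<^sub>1 \<inter> \<Union>F\<^sub>2 \<subseteq> K"
  shows "edges (separation_graph F\<^sub>1) \<inter> edges (separation_graph F\<^sub>2) = {}"
proof (rule equals0I)
  fix e
  assume "e \<in> edges (separation_graph F\<^sub>1) \<inter> edges (separation_graph F\<^sub>2)"
  then have "e \<subseteq> \<Union>F\<^sub>1" and "e \<subseteq> \<Union>F\<^sub>2" and "\<not> e \<subseteq> K"
    using assms(1) by (auto simp only: edges_separation_graph Int_iff mem_Collect_eq)
  then show False
    using assms(2) by blast
qed

lemma edges_biclique_separation_graph_disjoint:
  "edges (biclique_graph {\<Union>F\<^sub>1 - \<Union>F\<^sub>2, \<Union>F\<^sub>2 - \<Union>F\<^sub>1}) \<inter>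
     edges (graph_union (separation_graph F\<^sub>1) (separation_graph F\<^sub>2)) = {}"
  unfolding edges_biclique_graph_Diff graph_union_def snd_conv edges_separation_graph disjoint_iff
    Un_iff mem_Collect_eq
  by iprover

lemma not_subset_members_Un_iff:
  assumes "K \<in> F\<^sub>1" and "\<Union>F\<^sub>1 \<inter> \<Union>F\<^sub>2 \<subseteq> K" and "e \<subseteq> \<Union>F\<^sub>1"
  shows "(\<forall>M\<in>F\<^sub>1 \<union> F\<^sub>2. \<not> e \<subseteq> M) \<longleftrightarrow> (\<forall>M\<in>F\<^sub>1. \<not> e \<subseteq> M)"
proof -
  have "e \<subseteq> K" if "M \<in> F\<^sub>2" and "e \<subseteq> M" for M
  proof -
    have "e \<subseteq> \<Union>F\<^sub>2"
      using that by (rule Sup_upper2)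
    with assms(3) have "e \<subseteq> \<Union>F\<^sub>1 \<inter> \<Union>F\<^sub>2"
      by (rule Int_greatest)
    then show ?thesis
      using assms(2) by (rule subset_trans)
  qed
  then show ?thesis
    using assms(1) unfolding ball_Un by metis
qed

lemma separation_graph_Un:
  assumes "K\<^sub>1 \<in> F\<^sub>1" and "K\<^sub>2 \<in> F\<^sub>2" and "\<Union>F\<^sub>1 \<inter> \<Union>F\<^sub>2 \<subseteq> K\<^sub>1 \<inter> K\<^sub>2"
  shows "separation_graph (F\<^sub>1 \<union> F\<^sub>2) =
    graph_union (biclique_graph {\<Union>F\<^sub>1 - \<Union>F\<^sub>2, \<Union>F\<^sub>2 - \<Union>F\<^sub>1})
      (graph_union (separation_graph F\<^sub>1) (separation_graph F\<^sub>2))"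
    (is "?G = ?H")
proof (rule prod_eqI)
  show "verts ?G = verts ?H"
    unfolding graph_union_def verts_separation_graph
    by (auto simp: biclique_graph_def verts_separation_graph)
  show "edges ?G = edges ?H"
  proof (rule set_eqI)
    fix e
    have "(\<forall>K\<in>F\<^sub>1 \<union> F\<^sub>2. \<not> e \<subseteq> K) \<longleftrightarrow> (\<forall>K\<in>F\<^sub>1. \<not> e \<subseteq> K)" if "e \<subseteq> \<Union>F\<^sub>1"
      using not_subset_members_Un_iff[of K\<^sub>1 F\<^sub>1 F\<^sub>2 e] that assms(1,3) by (simp only: le_inf_iff)
    moreover have "(\<forall>K\<in>F\<^sub>1 \<union> F\<^sub>2. \<not> e \<subseteq> K) \<longleftrightarrow> (\<forall>K\<in>F\<^sub>2. \<not> e \<subseteq> K)" if "e \<subseteq> \<Union>F\<^sub>2"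
      using not_subset_members_Un_iff[of K\<^sub>2 F\<^sub>2 F\<^sub>1 e] that assms(2,3)
      by (simp only: Un_commute Int_commute le_inf_iff)
    moreover have "\<forall>K\<in>F\<^sub>1 \<union> F\<^sub>2. \<not> e \<subseteq> K" if "\<not> e \<subseteq> \<Union>F\<^sub>1" and "\<not> e \<subseteq> \<Union>F\<^sub>2"
      using that by blast
    moreover have "e \<subseteq> \<Union>F\<^sub>1 \<union> \<Union>F\<^sub>2" if "e \<subseteq> \<Union>F\<^sub>1 \<or> e \<subseteq> \<Union>F\<^sub>2"
      using that by blast
    ultimately show "e \<in> edges ?G \<longleftrightarrow> e \<in> edges ?H"
      unfolding graph_union_def snd_conv edges_separation_graph edges_biclique_graph_Diff
        Un_iff mem_Collect_eq Union_Un_distrib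
      by metis
  qed
qed

lemma biclique_partition_separation_graph_Un:
  assumes "K\<^sub>1 \<in> F\<^sub>1" and "K\<^sub>2 \<in> F\<^sub>2" and "\<Union>F\<^sub>1 \<inter> \<Union>F\<^sub>2 \<subseteq> K\<^sub>1 \<inter> K\<^sub>2"
    and "biclique_partition (separation_graph F\<^sub>1) P\<^sub>1"
    and "biclique_partition (separation_graph F\<^sub>2) P\<^sub>2"
  shows "biclique_partition (separation_graph (F\<^sub>1 \<union> F\<^sub>2))
    (insert {\<Union>F\<^sub>1 - \<Union>F\<^sub>2, \<Union>F\<^sub>2 - \<Union>F\<^sub>1} (P\<^sub>1 \<union> P\<^sub>2))"
proof -
  have "edges (separation_graph F\<^sub>1) \<inter> edges (separation_graph F\<^sub>2) = {}"
    using assms(1,3) by (intro edges_separation_graph_disjoint) auto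
  with assms(4,5) have halves: "biclique_partition
      (graph_union (separation_graph F\<^sub>1) (separation_graph F\<^sub>2)) (P\<^sub>1 \<union> P\<^sub>2)"
    by (rule biclique_partition_graph_union)
  have "(\<Union>F\<^sub>1 - \<Union>F\<^sub>2) \<inter> (\<Union>F\<^sub>2 - \<Union>F\<^sub>1) = {}"
    by blast
  then show ?thesis
    unfolding separation_graph_Un[OF assms(1-3)] insert_is_Un[of _ "P\<^sub>1 \<union> P\<^sub>2"]
    using biclique_partition_graph_union[OF biclique_partition_singleton halves
        edges_biclique_separation_graph_disjoint] by simp
qed

lemma card_biclique_partition_separation_graph_Un:
  assumes "K \<in> F\<^sub>1" and "\<Union>F\<^sub>1 \<inter> \<Union>F\<^sub>2 \<subseteq> K" and "\<not> \<Union>F\<^sub>1 \<subseteq> \<Union>F\<^sub>2" and "\<not> \<Union>F\<^sub>2 \<subseteq> \<Union>F\<^sub>1"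
    and P\<^sub>1: "biclique_partition (separation_graph F\<^sub>1) P\<^sub>1" "finite P\<^sub>1"
      "\<And>B. B \<in> P\<^sub>1 \<Longrightarrow> edges (biclique_graph B) \<noteq> {}"
    and P\<^sub>2: "biclique_partition (separation_graph F\<^sub>2) P\<^sub>2" "finite P\<^sub>2"
  shows "card (insert {\<Union>F\<^sub>1 - \<Union>F\<^sub>2, \<Union>F\<^sub>2 - \<Union>F\<^sub>1} (P\<^sub>1 \<union> P\<^sub>2)) = Suc (card P\<^sub>1 + card P\<^sub>2)"
proof -
  let ?B = "{\<Union>F\<^sub>1 - \<Union>F\<^sub>2, \<Union>F\<^sub>2 - \<Union>F\<^sub>1}"
  have disjoint: "edges (separation_graph F\<^sub>1) \<inter> edges (separation_graph F\<^sub>2) = {}"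
    using assms(1,2) by (rule edges_separation_graph_disjoint)
  have "card ({?B} \<union> (P\<^sub>1 \<union> P\<^sub>2)) = card {?B} + card (P\<^sub>1 \<union> P\<^sub>2)"
  proof (rule card_biclique_partition_graph_union)
    show "biclique_partition (biclique_graph ?B) {?B}"
      by (rule biclique_partition_singleton) blast
    show "biclique_partition
        (graph_union (separation_graph F\<^sub>1) (separation_graph F\<^sub>2)) (P\<^sub>1 \<union> P\<^sub>2)"
      using P\<^sub>1(1) P\<^sub>2(1) disjoint by (rule biclique_partition_graph_union)
    show "edges (biclique_graph B) \<noteq> {}" if "B \<in> {?B}" for B
      using that assms(3,4)
      by (metis singletonD edges_biclique_graph_empty_iff Diff_eq_empty_iff)
  qed (use P\<^sub>1(2) P\<^sub>2(2) edges_biclique_separation_graph_disjoint in simp_all)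
  moreover have "card (P\<^sub>1 \<union> P\<^sub>2) = card P\<^sub>1 + card P\<^sub>2"
    using P\<^sub>1(1) P\<^sub>2(1) disjoint P\<^sub>1(2) P\<^sub>2(2) P\<^sub>1(3) by (rule card_biclique_partition_graph_union)
  ultimately show ?thesis
    by simp
qed

lemma clique_iff_all_pairs: "clique H K \<longleftrightarrow> K \<subseteq> verts H \<and> all_pairs K \<subseteq> edges H"
  by (auto simp: clique_def all_pairs_def)

lemma clique_extends_to_maximal:
  assumes "finite (verts H)" and "clique H C"
  obtains K where "maximal_clique H K" and "C \<subseteq> K"
proof -
  have "finite {K. clique H K}"
    by (rule finite_subset[of _ "Pow (verts H)"]) (use assms(1) in \<open>auto simp: clique_def\<close>)
  then obtain K where "clique H K" "C \<subseteq> K" "\<forall>K'\<in>{K. clique H K}. K \<subseteq> K' \<longrightarrow> K = K'"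
    using finite_has_maximal2[of "{K. clique H K}" C] assms(2) by auto
  then have "maximal_clique H K"
    unfolding maximal_clique_def by auto
  then show thesis
    using \<open>C \<subseteq> K\<close> by (rule that)
qed

lemma clique_union_maximal_cliques:
  assumes "simple_graph H"
  shows "clique_union {K. maximal_clique H K} = H" (is "clique_union ?F = H")
proof -
  have finite: "finite (verts H)"
    using assms by (simp add: simple_graph_def)
  have "verts H \<subseteq> \<Union>?F"
  proof
    fix v assume "v \<in> verts H"
    then have "clique H {v}"
      by (simp add: clique_def)
    then obtain K where "maximal_clique H K" "{v} \<subseteq> K"
      by (rule clique_extends_to_maximal[OF finite])
    then show "v \<in> \<Union>?F"
      by blast
  qed
  moreover have "edges H \<subseteq> (\<Union>K\<in>?F. all_pairs K)"
  proof
    fix e assume e: "e \<in> edges H"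
    then have "e \<in> all_pairs (verts H)"
      using assms by (auto simp: simple_graph_def)
    then have pair: "e \<subseteq> verts H" "card e = 2"
      by (simp_all add: all_pairs_iff_card)
    have "f = e" if "f \<in> all_pairs e" for f
      using that pair(2) card_ge_0_finite[of e] card_subset_eq[of e f]
      by (simp add: all_pairs_iff_card)
    then have "clique H e"
      using e pair(1) by (auto simp: clique_iff_all_pairs)
    then obtain K where "maximal_clique H K" "e \<subseteq> K"
      by (rule clique_extends_to_maximal[OF finite])
    then show "e \<in> (\<Union>K\<in>?F. all_pairs K)"
      using pair(2) by (auto simp: all_pairs_iff_card)
  qed
  moreover have "\<Union>?F \<subseteq> verts H" "(\<Union>K\<in>?F. all_pairs K) \<subseteq> edges H"
    by (auto simp: maximal_clique_def clique_iff_all_pairs)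
  ultimately show ?thesis
    by (simp add: clique_union_def prod_eq_iff subset_antisym)
qed

lemma simple_graph_complement: "simple_graph G \<Longrightarrow> simple_graph (complement G)"
  by (auto simp: simple_graph_def complement_def)

lemma complement_complement: "simple_graph G \<Longrightarrow> complement (complement G) = G"
  by (auto simp: simple_graph_def complement_def prod_eq_iff)

lemma separation_graph_maximal_cliques_complement:
  "simple_graph G \<Longrightarrow> separation_graph {K. maximal_clique (complement G) K} = G"
  by (simp add: separation_graph_def clique_union_maximal_cliques simple_graph_complement
      complement_complement)

section \<open>The recursion on junction trees\<close>

definition junction_tree :: "'a set graph \<Rightarrow> bool" where
  "junction_tree T \<longleftrightarrow> tree T \<and>
     (\<forall>K\<^sub>1 K\<^sub>2 Ks K. path_between T K\<^sub>1 Ks K\<^sub>2 \<longrightarrow> K \<in> set Ks \<longrightarrow> K\<^sub>1 \<inter> K\<^sub>2 \<subseteq> K)"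

lemma junction_tree_imp_simple_graph: "junction_tree T \<Longrightarrow> simple_graph T"
  by (simp add: junction_tree_def tree_def)

lemma clique_tree_imp_junction_tree:
  assumes "clique_tree H T"
  shows "junction_tree T"
proof -
  have "K\<^sub>1 \<in> verts T \<and> K\<^sub>2 \<in> verts T" if "path_between T K\<^sub>1 Ks K\<^sub>2" for K\<^sub>1 K\<^sub>2 Ks
    using that by (auto simp: path_between_def)
  then show ?thesis
    using assms unfolding junction_tree_def clique_tree_def by blast
qed

lemma junction_tree_branches:
  assumes "junction_tree T" and "{a, b} \<in> edges T"
  shows "junction_tree (branch T a b)" and "junction_tree (branch T b a)"
proof -
  have "junction_tree (branch T c d)" if "c \<in> verts T" for c d
    using that assms(1) tree_branch[of T c d] path_between_subgraph[OF _ subgraph_branch[of T c d]]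
    unfolding junction_tree_def tree_iff_forest by blast
  then show "junction_tree (branch T a b)" and "junction_tree (branch T b a)"
    using simple_graph_edgeD[OF junction_tree_imp_simple_graph[OF assms(1)] assms(2)] by blast+
qed

lemma junction_tree_Union_branches_Int:
  assumes "junction_tree T" and "{a, b} \<in> edges T"
  shows "\<Union>(verts (branch T a b)) \<inter> \<Union>(verts (branch T b a)) = a \<inter> b" (is "\<Union>?A \<inter> \<Union>?B = _")
proof
  have tree: "tree T" and forest: "forest T"
    using assms(1) by (simp_all add: junction_tree_def tree_iff_forest)
  show "a \<inter> b \<subseteq> \<Union>?A \<inter> \<Union>?B"
    using ends_in_branches[OF tree_imp_simple_graph[OF tree] assms(2)] by blast
  show "\<Union>?A \<inter> \<Union>?B \<subseteq> a \<inter> b"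
  proof
    fix x assume "x \<in> \<Union>?A \<inter> \<Union>?B"
    then obtain K\<^sub>1 K\<^sub>2 where K: "K\<^sub>1 \<in> ?A" "K\<^sub>2 \<in> ?B" "x \<in> K\<^sub>1 \<inter> K\<^sub>2"
      by blast
    then have "K\<^sub>1 \<in> verts T" "K\<^sub>2 \<in> verts T"
      using branches_cover[OF tree assms(2)] by blast+
    then obtain Ks where Ks: "path_between T K\<^sub>1 Ks K\<^sub>2"
      using tree unfolding tree_def connected_graph_def by blast
    then have "a \<in> set Ks" "b \<in> set Ks"
      using path_between_branches_crosses[OF forest assms(2) _ K(1,2)] by simp_all
    then have "K\<^sub>1 \<inter> K\<^sub>2 \<subseteq> a" "K\<^sub>1 \<inter> K\<^sub>2 \<subseteq> b"
      using assms(1) Ks unfolding junction_tree_def by blast+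
    then show "x \<in> a \<inter> b"
      using K(3) by blast
  qed
qed

lemma find_partition_junction_tree_induct [consumes 2, case_names single branches]:
  assumes "find_partition T P" and "junction_tree T"
    and single: "\<And>T K. verts T = {K} \<Longrightarrow> Q T {}"
    and branches: "\<And>T a b P\<^sub>1 P\<^sub>2 U W. \<lbrakk>junction_tree T; {a, b} \<in> edges T;
      find_partition (branch T a b) P\<^sub>1; Q (branch T a b) P\<^sub>1;
      find_partition (branch T b a) P\<^sub>2; Q (branch T b a) P\<^sub>2;
      U = \<Union>(verts (branch T a b)); W = \<Union>(verts (branch T b a))\<rbrakk>
      \<Longrightarrow> Q T (insert {U - W, W - U} (P\<^sub>1 \<union> P\<^sub>2))"
  shows "Q T P"
  using assms(1,2)
proof (induction rule: find_partition.induct)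
  case (stop T)
  then have "card (verts T) = 1"
    by (auto simp: junction_tree_def tree_def le_Suc_eq)
  then obtain K where "verts T = {K}"
    by (rule card_1_singletonE)
  then show ?case
    by (rule single)
next
  case (split T a b A B L R P\<^sub>1 P\<^sub>2)
  let ?U = "\<Union>(verts (branch T a b))" and ?W = "\<Union>(verts (branch T b a))"
  have branch: "A = branch T a b" "B = branch T b a"
    using split.hyps(3,4) by (simp_all add: branch_def insert_commute)
  have "junction_tree A" "junction_tree B"
    using junction_tree_branches[OF split.prems \<open>{a, b} \<in> edges T\<close>] by (simp_all add: branch)
  moreover have "mid a b = ?U \<inter> ?W"
    using junction_tree_Union_branches_Int[OF split.prems \<open>{a, b} \<in> edges T\<close>]
    by (simp add: mid_def)
  then have "L = ?U - ?W" "R = ?W - ?U"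
    using split.hyps(5,6) by (simp_all add: branch Diff_Int)
  ultimately show ?case
    using branches[OF split.prems \<open>{a, b} \<in> edges T\<close>] split.hyps(7,8) split.IH
    by (simp add: branch)
qed

lemma find_partition_biclique_partition:
  assumes "find_partition T P" and "junction_tree T"
  shows "biclique_partition (separation_graph (verts T)) P"
  using assms
proof (induction rule: find_partition_junction_tree_induct)
  case (single T K)
  then show ?case
    by (auto simp: biclique_partition_def edges_separation_graph)
next
  case (branches T a b P\<^sub>1 P\<^sub>2 U W)
  have tree: "tree T"
    using branches by (simp add: junction_tree_def)
  note ends = ends_in_branches[OF tree_imp_simple_graph[OF tree] \<open>{a, b} \<in> edges T\<close>]
  show ?case
    unfolding branches_cover[OF tree \<open>{a, b} \<in> edges T\<close>, symmetric] \<open>U = _\<close> \<open>W = _\<close>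
    using branches junction_tree_Union_branches_Int[of T a b]
    by (intro biclique_partition_separation_graph_Un[OF ends]) auto
qed

definition antichain :: "'a set set \<Rightarrow> bool" where
  "antichain F \<longleftrightarrow> pairwise (\<lambda>K K'. \<not> K \<subseteq> K') F"

lemma antichain_maximal_cliques: "antichain {K. maximal_clique H K}"
  by (auto simp: antichain_def pairwise_def maximal_clique_def)

lemma antichain_branch: "antichain (verts T) \<Longrightarrow> antichain (verts (branch T a b))"
  using subgraph_branch[of T a b] by (auto simp: antichain_def subgraph_def intro: pairwise_subset)

lemma junction_tree_Union_branch_not_subset:
  assumes "junction_tree T" and "antichain (verts T)" and "{a, b} \<in> edges T"
  shows "\<not> \<Union>(verts (branch T a b)) \<subseteq> \<Union>(verts (branch T b a))"
proof
  assume "\<Union>(verts (branch T a b)) \<subseteq> \<Union>(verts (branch T b a))"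
  then have union: "\<Union>(verts (branch T a b)) = a \<inter> b"
    using junction_tree_Union_branches_Int[OF assms(1,3)] by blast
  note simple = junction_tree_imp_simple_graph[OF assms(1)]
  have "a \<subseteq> b"
    using union ends_in_branches(1)[OF simple assms(3)] by blast
  then show False
    using assms(2) simple_graph_edgeD[OF simple assms(3)] by (auto simp: antichain_def pairwise_def)
qed

lemma find_partition_finite: "find_partition T P \<Longrightarrow> finite P"
  by (induction rule: find_partition.induct) simp_all

lemma find_partition_edges_nonempty:
  assumes "find_partition T P" and "junction_tree T" and "antichain (verts T)" and "B \<in> P"
  shows "edges (biclique_graph B) \<noteq> {}"
  using assms
proof (induction rule: find_partition_junction_tree_induct)
  case (branches T a b P\<^sub>1 P\<^sub>2 U W)
  then have "\<not> U \<subseteq> W" "\<not> W \<subseteq> U"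
    using junction_tree_Union_branch_not_subset[of T a b]
      junction_tree_Union_branch_not_subset[of T b a]
    by (simp_all add: insert_commute)
  then have "edges (biclique_graph {U - W, W - U}) \<noteq> {}"
    by (simp add: edges_biclique_graph_empty_iff)
  then show ?case
    using branches antichain_branch by blast
qed simp

lemma find_partition_card:
  assumes "find_partition T P" and "junction_tree T" and "antichain (verts T)"
  shows "Suc (card P) = card (verts T)"
  using assms
proof (induction rule: find_partition_junction_tree_induct)
  case (branches T a b P\<^sub>1 P\<^sub>2 U W)
  let ?A = "branch T a b" and ?B = "branch T b a"
  have tree: "tree T" and edges: "{a, b} \<in> edges T" "{b, a} \<in> edges T"
    using \<open>junction_tree T\<close> \<open>{a, b} \<in> edges T\<close>
    by (simp_all add: junction_tree_def insert_commute)
  have sides: "junction_tree ?A" "antichain (verts ?A)" "junction_tree ?B" "antichain (verts ?B)"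
    using branches junction_tree_branches antichain_branch by blast+
  have "card (insert {U - W, W - U} (P\<^sub>1 \<union> P\<^sub>2)) = Suc (card P\<^sub>1 + card P\<^sub>2)"
    unfolding \<open>U = _\<close> \<open>W = _\<close>
  proof (rule card_biclique_partition_separation_graph_Un)
    show "a \<in> verts ?A"
      using tree_imp_simple_graph[OF tree] edges(1) by (rule ends_in_branches)
    show "\<Union>(verts ?A) \<inter> \<Union>(verts ?B) \<subseteq> a"
      using junction_tree_Union_branches_Int[of T a b] branches by blast
    show "\<not> \<Union>(verts ?A) \<subseteq> \<Union>(verts ?B)" "\<not> \<Union>(verts ?B) \<subseteq> \<Union>(verts ?A)"
      using junction_tree_Union_branch_not_subset branches edges by blast+
  qed (use branches sides find_partition_biclique_partition find_partition_finite
      find_partition_edges_nonempty in blast)+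
  moreover have "finite (verts ?A)" "finite (verts ?B)"
    using sides by (auto simp: junction_tree_def tree_def simple_graph_def)
  then have "card (verts T) = card (verts ?A) + card (verts ?B)"
    using branches_cover[OF tree edges(1)] branches_disjoint[OF _ edges(1)] tree
    by (metis card_Un_disjoint tree_iff_forest)
  ultimately show ?case
    using branches.IH sides by simp
qed simp

lemma find_partition_exists:
  assumes "tree T"
  shows "\<exists>P. find_partition T P"
  using assms
proof (induction "card (verts T)" arbitrary: T rule: less_induct)
  case less
  have simple: "simple_graph T" and finite: "finite (verts T)"
    using less.prems by (simp_all add: tree_def simple_graph_def)
  show ?case
  proof (cases "card (verts T) \<le> 1")
    case True
    then show ?thesis
      using finite find_partition.stop by blast
  next
    case False
    then obtain a b where edge: "{a, b} \<in> edges T"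
      using less.prems tree_ex_edge by (metis not_le)
    note ends = simple_graph_edgeD[OF simple edge]
    have forest: "forest T"
      using less.prems by (simp add: tree_iff_forest)
    note trees = tree_branch[OF forest ends(1)] tree_branch[OF forest ends(2)]
    have "verts (branch T a b) \<subset> verts T" "verts (branch T b a) \<subset> verts T"
      using branches_cover[OF less.prems edge] branches_disjoint[OF forest edge]
        ends_in_branches[OF simple edge] by blast+
    then obtain P\<^sub>1 P\<^sub>2
      where "find_partition (branch T a b) P\<^sub>1" "find_partition (branch T b a) P\<^sub>2"
      using less.hyps trees finite psubset_card_mono by metis
    then have "find_partition (component (delete_edge T {a, b}) a) P\<^sub>1"
      "find_partition (component (delete_edge T {a, b}) b) P\<^sub>2"
      by (simp_all add: branch_def insert_commute)
    then show ?thesis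
      using find_partition.split[OF _ edge refl refl refl refl] False by (metis not_le)
  qed
qed

lemma find_partition_clique_tree:
  assumes "simple_graph G" and "clique_tree (complement G) T" and "find_partition T P"
  shows "biclique_partition G P" and "card P = mc (complement G) - 1"
proof -
  have junction: "junction_tree T"
    using assms(2) by (rule clique_tree_imp_junction_tree)
  have verts: "verts T = {K. maximal_clique (complement G) K}"
    using assms(2) by (simp add: clique_tree_def)
  have "separation_graph (verts T) = G"
    using assms(1) unfolding verts by (rule separation_graph_maximal_cliques_complement)
  then show "biclique_partition G P"
    using find_partition_biclique_partition[OF assms(3) junction] by simp
  have "Suc (card P) = mc (complement G)"
    using find_partition_card[OF assms(3) junction] antichain_maximal_cliques[of "complement G"]
    by (simp add: verts mc_def)
  then show "card P = mc (complement G) - 1"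
    by simp
qed

theorem theorem2:
  fixes G :: "'a graph" and T :: "'a set graph"
  assumes "simple_graph G"
    and "co_chordal G"
    and "verts G \<noteq> {}"
    and "clique_tree (complement G) T"
  shows "(\<exists>P. find_partition T P) \<and>
         (\<forall>P. find_partition T P \<longrightarrow>
            biclique_partition G P \<and> card P = mc (complement G) - 1)"
proof -
  have "tree T"
    using assms(4) by (simp add: clique_tree_def)
  then have "\<exists>P. find_partition T P"
    by (rule find_partition_exists)
  then show ?thesis
    using find_partition_clique_tree[OF assms(1,4)] by blast
qed

end
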